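(* Let $K$ be a field with $\operatorname{char}K=0$ or $\operatorname{char}K=2$. Then: (i) the associative algebra $\mathbf A=\operatorname{Alg}(v_0,v_1)$ is not nil; (ii) if $\operatorname{char}K=2$, the restricted Lie algebra $\mathbf R=\operatorname{Lie}_p(v_0,v_1)$ is not nil.
   Context: Let $\Lambda=\Lambda(x_i\mid i\ge 0)$ be the Grassmann (exterior) algebra over $K$ on odd generators $x_0,x_1,\dots$ ($x_ix_j=-x_jx_i$, $x_i^2=0$), a $\mathbb Z_2$-graded algebra. In $\operatorname{End}\Lambda$ identify $x_i$ with left multiplication by $x_i$, and let $\partial_i$ be the odd superderivation of $\Lambda$ with $\partial_i(x_j)=\delta_{ij}$ (so $\partial_i(ab)=\partial_i(a)b+(-1)^{\deg a}a\,\partial_i(b)$). The pivot elements are the odd superderivations $v_i=\partial_i+x_ix_{i+1}(\partial_{i+2}+x_{i+2}x_{i+3}(\partial_{i+4}+\cdots))$, $i\ge 0$, that is, $v_i=\partial_i+x_ix_{i+1}v_{i+2}$ (well defined on $\Lambda$, since each element involves finitely many letters). $\mathbf A=\operatorname{Alg}(v_0,v_1)$ is the associative subalgebra (without unit) of $\operatorname{End}\Lambda$ generated by $v_0,v_1$. If $\operatorname{char}K=2$, $\operatorname{Lie}_p(v_0,v_1)$ is the smallest subspace of $\operatorname{End}\Lambda$ containing $v_0,v_1$ and closed under $[a,b]=ab+ba$ and the $p$-mapping $a\mapsto a^{[2]}=a^2$. An associative algebra is nil if every element is nilpotent. A restricted Lie algebra $L$ is nil if for every $x\in L$ there is $n$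 with $x^{[p^n]}=0$. *)

theory Defs
  imports Complex_Main "HOL-Library.Groups_Big_Fun"
begin

section \<open>The Grassmann algebra on countably many generators\<close>

text \<open>
  For a finite set \<open>S = {s\<^sub>1 < \<dots> < s\<^sub>m}\<close> of indices let \<open>x\<^sub>S = x\<^bsub>s\<^sub>1\<^esub> \<cdots> x\<^bsub>s\<^sub>m\<^esub>\<close>.  These monomials form
  a basis of the Grassmann algebra; an element \<open>\<Sum>\<^sub>S f(S) x\<^sub>S\<close> is represented by its coefficient
  function \<open>f\<close>, which is extended by \<open>0\<close> to the infinite sets.
\<close>

typedef (overloaded) 'k grassmann =
    "{f :: nat set \<Rightarrow> 'k::zero. finite {S. f S \<noteq> 0} \<and> (\<forall>S. f S \<noteq> 0 \<longrightarrow> finite S)}"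
  morphisms gcoeff Abs_grassmann
  by (rule exI[of _ "\<lambda>_. 0"]) simp

setup_lifting type_definition_grassmann

text \<open>
  For disjoint \<open>S\<close> and \<open>T\<close> one has \<open>x\<^sub>S x\<^sub>T = gsign S T \<cdot> x\<^bsub>S \<union> T\<^esub>\<close>: sorting the concatenated word
  takes one transposition for each inversion.
\<close>

definition gsign :: "nat set \<Rightarrow> nat set \<Rightarrow> 'k::comm_ring_1" where
  "gsign S T = (- 1) ^ card {(s, t). s \<in> S \<and> t \<in> T \<and> t < s}"

lemma finite_inversions: "finite S \<Longrightarrow> finite T \<Longrightarrow> finite {(s, t). s \<in> S \<and> t \<in> T \<and> t < (s::nat)}"
  by (rule finite_subset[of _ "S \<times> T"]) auto

lemma gsign_empty [simp]: "gsign {} T = 1" "gsign S {} = 1"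
  by (simp_all add: gsign_def)

lemma gsign_Un_left:
  assumes "finite A" "finite B" "finite C" "A \<inter> B = {}"
  shows "gsign (A \<union> B) C = gsign A C * gsign B C"
proof -
  have "{(s, t). s \<in> A \<union> B \<and> t \<in> C \<and> t < s} =
      {(s, t). s \<in> A \<and> t \<in> C \<and> t < s} \<union> {(s, t). s \<in> B \<and> t \<in> C \<and> t < s}"
    by auto
  moreover have "{(s, t). s \<in> A \<and> t \<in> C \<and> t < s} \<inter> {(s, t). s \<in> B \<and> t \<in> C \<and> t < s} = {}"
    using assms(4) by auto
  ultimately show ?thesis
    unfolding gsign_def using assms
    by (simp add: card_Un_disjoint finite_inversions power_add)
qed

lemma gsign_Un_right:
  assumes "finite A" "finite B" "finite C" "A \<inter> B = {}"
  shows "gsign C (A \<union> B) = gsign C A * gsign C B"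
proof -
  have "{(s, t). s \<in> C \<and> t \<in> A \<union> B \<and> t < s} =
      {(s, t). s \<in> C \<and> t \<in> A \<and> t < s} \<union> {(s, t). s \<in> C \<and> t \<in> B \<and> t < s}"
    by auto
  moreover have "{(s, t). s \<in> C \<and> t \<in> A \<and> t < s} \<inter> {(s, t). s \<in> C \<and> t \<in> B \<and> t < s} = {}"
    using assms(4) by auto
  ultimately show ?thesis
    unfolding gsign_def using assms
    by (simp add: card_Un_disjoint finite_inversions power_add)
qed

lemma gsign_square [simp]: "gsign S T * gsign S T = (1::'k::comm_ring_1)"
  by (simp add: gsign_def flip: power_mult_distrib)

lemma gsign_swap_singleton:
  assumes "finite S" "i \<notin> S"
  shows "gsign S {i} * gsign {i} S = ((- 1) ^ card S :: 'k::comm_ring_1)"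
proof -
  have "{(s, t). s \<in> S \<and> t \<in> {i} \<and> t < s} = (\<lambda>s. (s, i)) ` {s \<in> S. i < s}"
       "{(s, t). s \<in> {i} \<and> t \<in> S \<and> t < s} = (\<lambda>s. (i, s)) ` {s \<in> S. s < i}"
    by auto
  then have "gsign S {i} = ((- 1) ^ card {s \<in> S. i < s} :: 'k)"
       "gsign {i} S = ((- 1) ^ card {s \<in> S. s < i} :: 'k)"
    by (simp_all add: gsign_def card_image inj_on_def)
  moreover have "card {s \<in> S. i < s} + card {s \<in> S. s < i} = card S"
    using assms by (subst card_Un_disjoint[symmetric]) (auto intro!: arg_cong[of _ _ card] simp: not_less_iff_gr_or_eq)
  ultimately show ?thesis by (simp flip: power_add)
qed

lemma gcoeff_infinite: "infinite S \<Longrightarrow> gcoeff a S = 0"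
  by transfer auto

lemma finite_gsupport: "finite {S. gcoeff a S \<noteq> 0}"
  by transfer auto

lemma grassmann_eqI:
  assumes "\<And>S. finite S \<Longrightarrow> gcoeff a S = gcoeff b S"
  shows "a = b"
proof -
  have "gcoeff a S = gcoeff b S" for S
    using assms[of S] by (cases "finite S") (simp_all add: gcoeff_infinite)
  then show ?thesis by (intro gcoeff_inject[THEN iffD1] ext)
qed

instantiation grassmann :: (comm_ring_1) ring_1
begin

lift_definition zero_grassmann :: "'a grassmann" is "\<lambda>_. 0" by simp

lift_definition one_grassmann :: "'a grassmann" is "\<lambda>S. if S = {} then 1 else 0" by simp

lift_definition plus_grassmann :: "'a grassmann \<Rightarrow> 'a grassmann \<Rightarrow> 'a grassmann"
  is "\<lambda>f g S. f S + g S"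
proof -
  fix f g :: "nat set \<Rightarrow> 'a"
  assume *: "finite {S. f S \<noteq> 0} \<and> (\<forall>S. f S \<noteq> 0 \<longrightarrow> finite S)"
    "finite {S. g S \<noteq> 0} \<and> (\<forall>S. g S \<noteq> 0 \<longrightarrow> finite S)"
  have "{S. f S + g S \<noteq> 0} \<subseteq> {S. f S \<noteq> 0} \<union> {S. g S \<noteq> 0}" by auto
  then have "finite {S. f S + g S \<noteq> 0}" by (rule finite_subset) (use * in simp)
  moreover have "finite S" if "f S + g S \<noteq> 0" for S
    using * that by (cases "f S = 0") simp_all
  ultimately show "finite {S. f S + g S \<noteq> 0} \<and> (\<forall>S. f S + g S \<noteq> 0 \<longrightarrow> finite S)" by blast
qed

lift_definition uminus_grassmann :: "'a grassmann \<Rightarrow> 'a grassmann" is "\<lambda>f S. - f S"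
  by simp

definition minus_grassmann :: "'a grassmann \<Rightarrow> 'a grassmann \<Rightarrow> 'a grassmann" where
  "minus_grassmann a b = a + - b"

lift_definition times_grassmann :: "'a grassmann \<Rightarrow> 'a grassmann \<Rightarrow> 'a grassmann"
  is "\<lambda>f g U. \<Sum>S\<in>Pow U. gsign S (U - S) * f S * g (U - S)"
proof -
  fix f g :: "nat set \<Rightarrow> 'a"
  assume *: "finite {S. f S \<noteq> 0} \<and> (\<forall>S. f S \<noteq> 0 \<longrightarrow> finite S)"
    "finite {S. g S \<noteq> 0} \<and> (\<forall>S. g S \<noteq> 0 \<longrightarrow> finite S)"
  let ?h = "\<lambda>U. \<Sum>S\<in>Pow U. gsign S (U - S) * f S * g (U - S)"
  have nz: "\<exists>S\<in>Pow U. f S \<noteq> 0 \<and> g (U - S) \<noteq> 0" if "?h U \<noteq> 0" for U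
  proof (rule ccontr)
    assume "\<not> ?thesis"
    then have "\<forall>S\<in>Pow U. f S = 0 \<or> g (U - S) = 0" by blast
    then have "?h U = 0" by (intro sum.neutral) (metis mult_zero_left mult_zero_right)
    with that show False by simp
  qed
  have "{U. ?h U \<noteq> 0} \<subseteq> (\<lambda>(S, T). S \<union> T) ` ({S. f S \<noteq> 0} \<times> {S. g S \<noteq> 0})"
  proof
    fix U assume "U \<in> {U. ?h U \<noteq> 0}"
    then obtain S where "S \<subseteq> U" "f S \<noteq> 0" "g (U - S) \<noteq> 0" using nz[of U] by auto
    then show "U \<in> (\<lambda>(S, T). S \<union> T) ` ({S. f S \<noteq> 0} \<times> {S. g S \<noteq> 0})"
      by (intro image_eqI[of _ _ "(S, U - S)"]) auto
  qed
  moreover have "finite U" if "?h U \<noteq> 0" for U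
  proof (rule ccontr)
    assume "infinite U"
    then have "?h U = 0" by simp
    with that show False by simp
  qed
  moreover have "finite ((\<lambda>(S, T). S \<union> T) ` ({S. f S \<noteq> 0} \<times> {S. g S \<noteq> 0}))"
    using * by simp
  ultimately show "finite {U. ?h U \<noteq> 0} \<and> (\<forall>U. ?h U \<noteq> 0 \<longrightarrow> finite U)"
    by (meson finite_subset)
qed

instance
proof
  fix a b c :: "'a grassmann"
  show "a + b + c = a + (b + c)" by transfer (simp add: fun_eq_iff add.assoc)
  show "a + b = b + a" by transfer (simp add: fun_eq_iff add.commute)
  show "0 + a = a" by transfer simp
  show "- a + a = 0" by transfer simp
  show "a - b = a + - b" by (simp add: minus_grassmann_def)
  show "(a + b) * c = a * c + b * c"
    by transfer (simp add: fun_eq_iff algebra_simps sum.distrib)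
  show "a * (b + c) = a * b + a * c"
    by transfer (simp add: fun_eq_iff algebra_simps sum.distrib)
  show "(0::'a grassmann) \<noteq> 1" by transfer (auto simp: fun_eq_iff)
  show "1 * a = a"
  proof (rule grassmann_eqI)
    fix U :: "nat set" assume U: "finite U"
    have "gcoeff (1 * a) U =
        (\<Sum>S\<in>Pow U. if S = {} then gcoeff a U else 0)"
      unfolding times_grassmann.rep_eq one_grassmann.rep_eq by (rule sum.cong) auto
    then show "gcoeff (1 * a) U = gcoeff a U" using U by simp
  qed
  show "a * 1 = a"
  proof (rule grassmann_eqI)
    fix U :: "nat set" assume U: "finite U"
    have "gcoeff (a * 1) U =
        (\<Sum>S\<in>Pow U. if S = U then gcoeff a U else 0)"
      unfolding times_grassmann.rep_eq one_grassmann.rep_eq by (rule sum.cong) auto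
    then show "gcoeff (a * 1) U = gcoeff a U" using U by simp
  qed
  show "a * b * c = a * (b * c)"
  proof (rule grassmann_eqI)
    fix U :: "nat set" assume U: "finite U"
    let ?a = "gcoeff a" and ?b = "gcoeff b" and ?c = "gcoeff c"
    have "gcoeff (a * b * c) U = (\<Sum>W\<in>Pow U. \<Sum>S\<in>Pow W.
        gsign W (U - W) * gsign S (W - S) * ?a S * ?b (W - S) * ?c (U - W))"
      unfolding times_grassmann.rep_eq
      by (simp add: sum_distrib_left sum_distrib_right mult.assoc)
    also have "\<dots> = (\<Sum>(W, S)\<in>(SIGMA W:Pow U. Pow W).
        gsign W (U - W) * gsign S (W - S) * ?a S * ?b (W - S) * ?c (U - W))"
      using U by (subst sum.Sigma) (auto intro: finite_subset)
    also have "\<dots> = (\<Sum>(S, T)\<in>(SIGMA S:Pow U. Pow (U - S)).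
        gsign S (U - S) * gsign T (U - S - T) * ?a S * ?b T * ?c (U - S - T))"
    proof (rule sum.reindex_bij_witness[where i = "\<lambda>(S, T). (S \<union> T, S)" and j = "\<lambda>(W, S). (S, W - S)"],
        goal_cases)
      case (5 p)
      then obtain W S where p: "p = (W, S)" "W \<subseteq> U" "S \<subseteq> W" by auto
      define T R where "T = W - S" and "R = U - W"
      have fin: "finite S" "finite T" "finite R"
        using p U by (auto simp: T_def R_def intro: finite_subset)
      have eqs: "W = S \<union> T" "U - S = T \<union> R" "U - S - T = R" "S \<inter> T = {}" "T \<inter> R = {}"
        using p by (auto simp: T_def R_def)
      have "gsign W R * gsign S T = (gsign S (T \<union> R) * gsign T R :: 'a)"
        unfolding eqs(1) using fin eqs by (simp add: gsign_Un_left gsign_Un_right ac_simps)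
      then show ?case
        unfolding p(1) using eqs(2,3) by (simp flip: T_def R_def)
    qed auto
    also have "\<dots> = (\<Sum>S\<in>Pow U. \<Sum>T\<in>Pow (U - S).
        gsign S (U - S) * gsign T (U - S - T) * ?a S * ?b T * ?c (U - S - T))"
      using U by (subst sum.Sigma) (auto intro: finite_subset)
    also have "\<dots> = gcoeff (a * (b * c)) U"
      unfolding times_grassmann.rep_eq
      by (simp add: sum_distrib_left sum_distrib_right ac_simps)
    finally show "gcoeff (a * b * c) U = gcoeff (a * (b * c)) U" .
  qed
qed

end

lift_definition gscale :: "'k::comm_ring_1 \<Rightarrow> 'k grassmann \<Rightarrow> 'k grassmann"
  is "\<lambda>c f S. c * f S"
proof -
  fix c :: 'k and f :: "nat set \<Rightarrow> 'k"
  assume *: "finite {S. f S \<noteq> 0} \<and> (\<forall>S. f S \<noteq> 0 \<longrightarrow> finite S)"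
  have "{S. c * f S \<noteq> 0} \<subseteq> {S. f S \<noteq> 0}" by auto
  then have "finite {S. c * f S \<noteq> 0}" by (rule finite_subset) (use * in simp)
  moreover have "finite S" if "c * f S \<noteq> 0" for S
    using * that by (cases "f S = 0") simp_all
  ultimately show "finite {S. c * f S \<noteq> 0} \<and> (\<forall>S. c * f S \<noteq> 0 \<longrightarrow> finite S)" by blast
qed

lift_definition gx :: "nat \<Rightarrow> 'k::comm_ring_1 grassmann" is "\<lambda>i S. if S = {i} then 1 else 0"
  by simp

lemma gcoeff_simps [simp]:
  "gcoeff 0 S = 0" "gcoeff (a + b) S = gcoeff a S + gcoeff b S" "gcoeff (- a) S = - gcoeff a S"
  "gcoeff (a - b) S = gcoeff a S - gcoeff b S" "gcoeff (gscale c a) S = c * gcoeff a S"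
  unfolding minus_grassmann_def zero_grassmann.rep_eq plus_grassmann.rep_eq uminus_grassmann.rep_eq
    gscale.rep_eq by (rule refl | simp only: diff_conv_add_uminus)+

interpretation grassmann: vector_space "gscale :: 'k::field \<Rightarrow> _"
proof
  fix a b :: 'k and x y :: "'k grassmann"
  show "gscale a (x + y) = gscale a x + gscale a y"
    by (rule grassmann_eqI) (simp add: distrib_left)
  show "gscale (a + b) x = gscale a x + gscale b x"
    by (rule grassmann_eqI) (simp add: distrib_right)
  show "gscale a (gscale b x) = gscale (a * b) x"
    by (rule grassmann_eqI) simp
  show "gscale 1 x = x"
    by (rule grassmann_eqI) simp
qed

lemma gscale_mult_left: "gscale c a * b = gscale c (a * b)"
  unfolding gcoeff_inject[symmetric] fun_eq_iff gscale.rep_eq times_grassmann.rep_eq sum_distrib_left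
  by (intro allI sum.cong refl) (simp only: ac_simps)

lemma gscale_mult_right: "a * gscale c b = gscale c (a * b)"
  unfolding gcoeff_inject[symmetric] fun_eq_iff gscale.rep_eq times_grassmann.rep_eq sum_distrib_left
  by (intro allI sum.cong refl) (simp only: ac_simps)

lemma gcoeff_sum: "gcoeff (\<Sum>i\<in>I. f i) S = (\<Sum>i\<in>I. gcoeff (f i) S)"
  by (induction I rule: infinite_finite_induct) simp_all

lemma gcoeff_gx_mult:
  assumes "finite U"
  shows "gcoeff (gx i * a) U = (if i \<in> U then gsign {i} (U - {i}) * gcoeff a (U - {i}) else 0)"
proof -
  have "gcoeff (gx i * a) U =
      (\<Sum>S\<in>Pow U. if S = {i} then gsign {i} (U - {i}) * gcoeff a (U - {i}) else 0)"
    unfolding times_grassmann.rep_eq gx.rep_eq by (rule sum.cong) auto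
  then show ?thesis using assms by simp
qed

lemma gx_square: "gx i * gx i = 0"
  by (rule grassmann_eqI) (auto simp: gcoeff_gx_mult gx.rep_eq)

lemma gx_anticommute: "gx i * gx j = - (gx j * gx i :: 'k::comm_ring_1 grassmann)"
proof (cases "i = j")
  case True
  then show ?thesis by (simp add: gx_square)
next
  case False
  show ?thesis
  proof (rule grassmann_eqI)
    fix U :: "nat set" assume U: "finite U"
    have *: "i \<in> U \<and> U - {i} = {j} \<longleftrightarrow> U = {i, j}" "j \<in> U \<and> U - {j} = {i} \<longleftrightarrow> U = {i, j}"
      using False by auto
    have "gsign {i} {j} = - (gsign {j} {i} :: 'k)"
    proof -
      have "gsign {i} {j} * gsign {j} {i} = (- 1 :: 'k)"
        using gsign_swap_singleton[of "{i}" j] False by simp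
      then have "gsign {i} {j} * gsign {j} {i} * gsign {j} {i} = - (gsign {j} {i} :: 'k)"
        by (simp only: mult_minus1)
      then show ?thesis by (simp only: mult.assoc gsign_square mult_1_right)
    qed
    then show "gcoeff (gx i * gx j) U = gcoeff (- (gx j * gx i) :: 'k grassmann) U"
      using * False
      by (cases "U = {i, j}") (auto simp: gcoeff_gx_mult gx.rep_eq insert_Diff_if U)
  qed
qed

definition gmono :: "nat set \<Rightarrow> 'k::comm_ring_1 grassmann" where
  "gmono S = prod_list (map gx (sorted_list_of_set S))"

lemma gcoeff_prod_list_gx:
  assumes "sorted_wrt (<) xs" "finite U"
  shows "gcoeff (prod_list (map gx xs)) U = (if U = set xs then 1 else (0 :: 'k::comm_ring_1))"
  using assms
proof (induction xs arbitrary: U)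
  case Nil
  then show ?case by (simp add: one_grassmann.rep_eq)
next
  case (Cons i xs)
  have lt: "\<forall>j\<in>set xs. i < j" using Cons.prems by simp
  then have "{(s, t). s \<in> {i} \<and> t \<in> set xs \<and> t < s} = {}" by auto
  then have sgn: "gsign {i} (set xs) = (1 :: 'k)" by (simp only: gsign_def card.empty power_0)
  have eq: "i \<in> U \<and> U - {i} = set xs \<longleftrightarrow> U = set (i # xs)"
    using lt by auto
  show ?case
  proof (cases "U = set (i # xs)")
    case True
    with eq have "i \<in> U" "U - {i} = set xs" by blast+
    then show ?thesis using Cons True by (simp add: gcoeff_gx_mult sgn del: set_simps) 
  next
    case False
    with eq have "i \<notin> U \<or> U - {i} \<noteq> set xs" by blast
    then show ?thesis using Cons False by (auto simp: gcoeff_gx_mult simp del: set_simps)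
  qed
qed

lemma gcoeff_gmono:
  "finite S \<Longrightarrow> gcoeff (gmono S) U = (if U = S then 1 else (0 :: 'k::comm_ring_1))"
  by (cases "finite U") (auto simp: gmono_def gcoeff_prod_list_gx gcoeff_infinite)

lemma gmono_expansion: "a = (\<Sum>S | gcoeff a S \<noteq> 0. gscale (gcoeff a S) (gmono S))"
proof (rule grassmann_eqI)
  fix U :: "nat set" assume "finite U"
  have "gcoeff (\<Sum>S | gcoeff a S \<noteq> 0. gscale (gcoeff a S) (gmono S)) U =
      (\<Sum>S | gcoeff a S \<noteq> 0. if U = S then gcoeff a U else 0)"
    unfolding gcoeff_sum
  proof (rule sum.cong[OF refl])
    fix S assume "S \<in> {S. gcoeff a S \<noteq> 0}"
    then have "finite S" using gcoeff_infinite by blast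
    then show "gcoeff (gscale (gcoeff a S) (gmono S)) U = (if U = S then gcoeff a U else 0)"
      by (simp add: gcoeff_gmono)
  qed
  then show "gcoeff a U = gcoeff (\<Sum>S | gcoeff a S \<noteq> 0. gscale (gcoeff a S) (gmono S)) U"
    by (simp add: finite_gsupport)
qed


section \<open>Odd superderivations\<close>

text \<open>\<open>a\<close> is homogeneous of \<open>\<int>\<^sub>2\<close>-degree \<open>d mod 2\<close>; the zero element has every degree.\<close>

definition homogeneous :: "nat \<Rightarrow> 'k::zero grassmann \<Rightarrow> bool" where
  "homogeneous d a \<longleftrightarrow> (\<forall>S. gcoeff a S \<noteq> 0 \<longrightarrow> card S mod 2 = d mod 2)"

definition odd_superderivation :: "('k::field grassmann \<Rightarrow> 'k grassmann) \<Rightarrow> bool" where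
  "odd_superderivation D \<longleftrightarrow> Vector_Spaces.linear gscale gscale D \<and>
     (\<forall>d a. homogeneous d a \<longrightarrow> homogeneous (d + 1) (D a)) \<and>
     (\<forall>d a b. homogeneous d a \<longrightarrow> D (a * b) = D a * b + (- 1) ^ d * a * D b)"

definition gpartial :: "nat \<Rightarrow> 'k::field grassmann \<Rightarrow> 'k grassmann" where
  "gpartial i = (THE D. odd_superderivation D \<and> (\<forall>j. D (gx j) = (if i = j then 1 else 0)))"

text \<open>Existence and uniqueness of \<open>gpartial i\<close>, with an explicit formula for the coefficients.\<close>

lift_definition gpartial_expl :: "nat \<Rightarrow> 'k::comm_ring_1 grassmann \<Rightarrow> 'k grassmann"
  is "\<lambda>i f U. if i \<in> U then 0 else gsign {i} U * f (insert i U)"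
proof -
  fix i and f :: "nat set \<Rightarrow> 'k"
  assume *: "finite {S. f S \<noteq> 0} \<and> (\<forall>S. f S \<noteq> 0 \<longrightarrow> finite S)"
  let ?g = "\<lambda>U. if i \<in> U then 0 else gsign {i} U * f (insert i U)"
  have nz: "i \<notin> U \<and> f (insert i U) \<noteq> 0" if "?g U \<noteq> 0" for U
    using that by (cases "i \<in> U"; cases "f (insert i U) = 0") simp_all
  have sub: "{U. ?g U \<noteq> 0} \<subseteq> (\<lambda>S. S - {i}) ` {S. f S \<noteq> 0}"
  proof
    fix U assume "U \<in> {U. ?g U \<noteq> 0}"
    then have U: "i \<notin> U \<and> f (insert i U) \<noteq> 0" by (intro nz) (rule CollectD)
    then have "U = insert i U - {i}" by simp
    moreover have "insert i U \<in> {S. f S \<noteq> 0}" using U by simp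
    ultimately show "U \<in> (\<lambda>S. S - {i}) ` {S. f S \<noteq> 0}" by (rule image_eqI)
  qed
  show "finite {U. ?g U \<noteq> 0} \<and> (\<forall>U. ?g U \<noteq> 0 \<longrightarrow> finite U)"
  proof (rule conjI, rule finite_subset[OF sub], rule finite_imageI[OF conjunct1[OF *]],
      rule allI, rule impI)
    fix U assume "?g U \<noteq> 0"
    from nz[OF this] have "finite (insert i U)" by (intro conjunct2[OF *, THEN spec, THEN mp]) (rule conjunct2)
    then show "finite U" by simp
  qed
qed

lemma sum_Pow_insert:
  assumes "finite U" "i \<notin> U"
  shows "(\<Sum>S\<in>Pow (insert i U). g S) = (\<Sum>S\<in>Pow U. g S + g (insert i S))"
proof -
  have "(\<Sum>S\<in>Pow (insert i U). g S) = sum g (Pow U) + sum g (insert i ` Pow U)"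
    unfolding Pow_insert using assms by (intro sum.union_disjoint) auto
  also have "sum g (insert i ` Pow U) = (\<Sum>S\<in>Pow U. g (insert i S))"
    using assms by (subst sum.reindex) (auto simp: inj_on_def)
  finally show ?thesis by (simp add: sum.distrib)
qed

lemma gcoeff_minus_one_power_mult: "gcoeff ((- 1) ^ d * a) S = (- 1) ^ d * gcoeff a S"
  by (induction d) simp_all

lemma homogeneous_coeff:
  assumes "homogeneous d a"
  shows "(- 1) ^ d * gcoeff a S = (- 1) ^ card S * (gcoeff a S :: 'k::comm_ring_1)"
proof (cases "gcoeff a S = 0")
  case False
  then have "card S mod 2 = d mod 2" using assms by (simp add: homogeneous_def)
  then have "even (card S) \<longleftrightarrow> even d" by presburger
  then show ?thesis by (auto simp: minus_one_power_iff)
qed simp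

lemma gpartial_expl_mult:
  fixes a b :: "'k::comm_ring_1 grassmann"
  assumes "homogeneous d a"
  shows "gpartial_expl i (a * b) = gpartial_expl i a * b + (- 1) ^ d * a * gpartial_expl i b"
proof (rule grassmann_eqI)
  fix U :: "nat set" assume U: "finite U"
  let ?a = "gcoeff a" and ?b = "gcoeff b" and ?D = "gpartial_expl i"
  have rhs: "gcoeff (?D a * b + (- 1) ^ d * a * ?D b) V =
      (\<Sum>S\<in>Pow V. gsign S (V - S) * gcoeff (?D a) S * ?b (V - S)
        + (- 1) ^ card S * gsign S (V - S) * ?a S * gcoeff (?D b) (V - S))" for V
  proof -
    have "(- 1) ^ d * (gsign S T * gcoeff a S * z) = (- 1) ^ card S * gsign S T * gcoeff a S * z"
      for S T and z :: 'k
    proof -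
      have "(- 1) ^ d * (gsign S T * gcoeff a S * z) = ((- 1) ^ d * gcoeff a S) * (gsign S T * z)"
        by (simp only: ac_simps)
      also have "\<dots> = (- 1) ^ card S * gsign S T * gcoeff a S * z"
        unfolding homogeneous_coeff[OF assms] by (simp only: ac_simps)
      finally show ?thesis .
    qed
    then show ?thesis
      unfolding mult.assoc[of "(- 1) ^ d" a] gcoeff_simps gcoeff_minus_one_power_mult
      unfolding times_grassmann.rep_eq sum.distrib sum_distrib_left by (simp only:)
  qed
  show "gcoeff (?D (a * b)) U = gcoeff (?D a * b + (- 1) ^ d * a * ?D b) U"
  proof (cases "i \<in> U")
    case False
    have "gcoeff (?D (a * b)) U = gsign {i} U * gcoeff (a * b) (insert i U)"
      using False by (simp add: gpartial_expl.rep_eq)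
    also have "\<dots> = (\<Sum>S\<in>Pow U.
        gsign {i} U * (gsign S (insert i U - S) * ?a S * ?b (insert i U - S)) +
        gsign {i} U * (gsign (insert i S) (insert i U - insert i S) * ?a (insert i S) *
          ?b (insert i U - insert i S)))"
      unfolding times_grassmann.rep_eq sum_Pow_insert[OF U False]
      by (simp add: sum_distrib_left distrib_left)
    also have "\<dots> = (\<Sum>S\<in>Pow U. gsign S (U - S) * gcoeff (?D a) S * ?b (U - S)
        + (- 1) ^ card S * gsign S (U - S) * ?a S * gcoeff (?D b) (U - S))"
    proof (rule sum.cong[OF refl])
      fix S assume "S \<in> Pow U"
      define T where "T = U - S"
      have i: "i \<notin> S" "i \<notin> T" and disj: "S \<inter> T = {}" and UST: "U = S \<union> T"
        and fin: "finite S" "finite T"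
        using False \<open>S \<in> Pow U\<close> U by (auto simp: T_def intro: finite_subset)
      have sets: "insert i U - S = {i} \<union> T" "insert i U - ({i} \<union> S) = T" "insert i S = {i} \<union> S"
        "U - S = T"
        using i disj by (auto simp: T_def)
      have s1: "gsign {i} U = (gsign {i} S * gsign {i} T :: 'k)"
        unfolding UST using fin disj by (simp add: gsign_Un_right)
      have s2: "gsign S ({i} \<union> T) = (gsign S {i} * gsign S T :: 'k)"
        by (rule gsign_Un_right) (use fin i in auto)
      have s3: "gsign ({i} \<union> S) T = (gsign {i} T * gsign S T :: 'k)"
        by (rule gsign_Un_left) (use fin i in auto)
      have s4: "gsign {i} S * gsign S {i} = ((- 1) ^ card S :: 'k)"
        using gsign_swap_singleton[OF fin(1) i(1)] by (simp add: mult.commute)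
      have t1: "gsign {i} U * (gsign S ({i} \<union> T) * ?a S * ?b ({i} \<union> T)) =
          (gsign {i} S * gsign S {i}) * gsign S T * ?a S * (gsign {i} T * ?b ({i} \<union> T))"
        unfolding s1 s2 by (simp only: ac_simps)
      have t2: "gsign {i} U * (gsign ({i} \<union> S) T * ?a ({i} \<union> S) * ?b T) =
          (gsign {i} T * gsign {i} T) * (gsign S T * (gsign {i} S * ?a ({i} \<union> S)) * ?b T)"
        unfolding s1 s3 by (simp only: ac_simps)
      show "gsign {i} U * (gsign S (insert i U - S) * ?a S * ?b (insert i U - S)) +
        gsign {i} U * (gsign (insert i S) (insert i U - insert i S) * ?a (insert i S) *
          ?b (insert i U - insert i S)) =
        gsign S (U - S) * gcoeff (?D a) S * ?b (U - S)
        + (- 1) ^ card S * gsign S (U - S) * ?a S * gcoeff (?D b) (U - S)"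
        unfolding sets t1 t2 s4 using i by (simp add: gpartial_expl.rep_eq)
    qed
    also have "\<dots> = gcoeff (?D a * b + (- 1) ^ d * a * ?D b) U"
      by (rule rhs[symmetric])
    finally show ?thesis .
  next
    case True
    define W where "W = U - {i}"
    have W: "U = insert i W" "i \<notin> W" "finite W" using True U by (auto simp: W_def)
    have "gcoeff (?D a * b + (- 1) ^ d * a * ?D b) U = (\<Sum>S\<in>Pow W. 0)"
      unfolding rhs unfolding W(1) sum_Pow_insert[OF W(3,2)]
    proof (rule sum.cong[OF refl])
      fix S assume "S \<in> Pow W"
      define T where "T = W - S"
      have i: "i \<notin> S" "i \<notin> T" and disj: "S \<inter> T = {}" and UST: "W = S \<union> T"
        and fin: "finite S" "finite T"
        using W \<open>S \<in> Pow W\<close> by (auto simp: T_def intro: finite_subset)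
      have sets: "insert i W - S = {i} \<union> T" "insert i W - ({i} \<union> S) = T" "insert i S = {i} \<union> S"
        using i disj by (auto simp: T_def)
      have s2: "gsign S ({i} \<union> T) = (gsign S {i} * gsign S T :: 'k)"
        by (rule gsign_Un_right) (use fin i in auto)
      have s3: "gsign ({i} \<union> S) T = (gsign {i} T * gsign S T :: 'k)"
        by (rule gsign_Un_left) (use fin i in auto)
      have s4: "gsign S {i} * gsign {i} S = ((- 1) ^ card S :: 'k)"
        by (rule gsign_swap_singleton[OF fin(1) i(1)])
      have c: "card ({i} \<union> S) = Suc (card S)" using fin i by simp
      have da: "gcoeff (?D a) S = gsign {i} S * ?a ({i} \<union> S)"
        "gcoeff (?D b) ({i} \<union> T) = 0" "gcoeff (?D a) ({i} \<union> S) = 0"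
        "gcoeff (?D b) T = gsign {i} T * ?b ({i} \<union> T)"
        using i by (simp_all add: gpartial_expl.rep_eq)
      have u1: "gsign S ({i} \<union> T) * gcoeff (?D a) S * ?b ({i} \<union> T) =
          (gsign S {i} * gsign {i} S) * gsign S T * ?a ({i} \<union> S) * ?b ({i} \<union> T)"
        unfolding s2 da by (simp only: ac_simps)
      have u2: "(- 1) ^ card ({i} \<union> S) * gsign ({i} \<union> S) T * ?a ({i} \<union> S) * gcoeff (?D b) T =
          - ((- 1) ^ card S * gsign S T * ?a ({i} \<union> S) * ?b ({i} \<union> T) * (gsign {i} T * gsign {i} T))"
        unfolding s3 da c
        by (simp only: power_Suc mult_1_left mult_minus_left mult_minus_right ac_simps)
      show "gsign S (insert i W - S) * gcoeff (?D a) S * ?b (insert i W - S) +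
        (- 1) ^ card S * gsign S (insert i W - S) * ?a S * gcoeff (?D b) (insert i W - S) +
        (gsign (insert i S) (insert i W - insert i S) * gcoeff (?D a) (insert i S) *
          ?b (insert i W - insert i S) +
         (- 1) ^ card (insert i S) * gsign (insert i S) (insert i W - insert i S) *
          ?a (insert i S) * gcoeff (?D b) (insert i W - insert i S)) = 0"
        unfolding sets u1 u2 s4 da(2,3) by simp
    qed
    then show ?thesis using True by (simp add: gpartial_expl.rep_eq)
  qed
qed

lemma odd_superderivation_gpartial_expl:
  "odd_superderivation (gpartial_expl i :: 'k::field grassmann \<Rightarrow> _)"
  unfolding odd_superderivation_def
proof (intro conjI allI impI)
  show "Vector_Spaces.linear gscale gscale (gpartial_expl i :: 'k grassmann \<Rightarrow> _)"
    unfolding Vector_Spaces.linear_iff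
    by (intro conjI allI grassmann.vector_space_axioms grassmann_eqI)
      (simp_all add: gpartial_expl.rep_eq algebra_simps)
  show "homogeneous (d + 1) (gpartial_expl i a)"
    if "homogeneous d a" for d and a :: "'k grassmann"
    unfolding homogeneous_def
  proof (intro allI impI)
    fix S assume nz: "gcoeff (gpartial_expl i a) S \<noteq> 0"
    then have "i \<notin> S" "gcoeff a (insert i S) \<noteq> 0"
      by (auto simp: gpartial_expl.rep_eq split: if_splits)
    moreover have "finite S" using nz gcoeff_infinite by blast
    ultimately have "Suc (card S) mod 2 = d mod 2"
      using that unfolding homogeneous_def by (simp flip: card_insert_disjoint)
    then show "card S mod 2 = (d + 1) mod 2" by presburger
  qed
qed (rule gpartial_expl_mult)

lemma gpartial_expl_gx: "gpartial_expl i (gx j) = (if i = j then 1 else 0)"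
  by (rule grassmann_eqI)
    (auto simp: gpartial_expl.rep_eq gx.rep_eq one_grassmann.rep_eq)

lemma homogeneous_gx: "homogeneous 1 (gx i)"
  by (simp add: homogeneous_def gx.rep_eq)

lemma homogeneous_one: "homogeneous 0 1"
  by (simp add: homogeneous_def one_grassmann.rep_eq)

lemma odd_superderivation_mult:
  "odd_superderivation D \<Longrightarrow> homogeneous d a \<Longrightarrow> D (a * b) = D a * b + (- 1) ^ d * a * D b"
  by (simp add: odd_superderivation_def)

lemma odd_superderivation_unique:
  fixes D D' :: "'k::field grassmann \<Rightarrow> 'k grassmann"
  assumes D: "odd_superderivation D" and D': "odd_superderivation D'"
    and gx: "\<And>j. D (gx j) = D' (gx j)"
  shows "D = D'"
proof
  fix a :: "'k grassmann"
  have one: "E 1 = 0" if "odd_superderivation E" for E :: "'k grassmann \<Rightarrow> 'k grassmann"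
  proof -
    have "E (1 * 1) = E 1 * 1 + (- 1) ^ 0 * 1 * E 1"
      by (rule odd_superderivation_mult[OF that homogeneous_one])
    then show ?thesis by simp
  qed
  have mult: "E (gx i * b) = E (gx i) * b + (- 1) ^ 1 * gx i * E b"
    if "odd_superderivation E" for E :: "'k grassmann \<Rightarrow> 'k grassmann" and i b
    by (rule odd_superderivation_mult[OF that homogeneous_gx])
  have prod: "D (prod_list (map gx xs)) = D' (prod_list (map gx xs))" for xs
    by (induction xs) (simp_all add: one mult D D' gx)
  interpret D: Vector_Spaces.linear gscale gscale D using D by (simp add: odd_superderivation_def)
  interpret D': Vector_Spaces.linear gscale gscale D' using D' by (simp add: odd_superderivation_def)
  have "D (\<Sum>S\<in>I. gscale (c S) (gmono S)) = D' (\<Sum>S\<in>I. gscale (c S) (gmono S))" for I c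
    by (simp only: D.sum D'.sum D.scale D'.scale gmono_def prod)
  from this[of "gcoeff a" "{S. gcoeff a S \<noteq> 0}"] show "D a = D' a"
    by (simp only: gmono_expansion[symmetric])
qed

lemma gpartial_unique:
  "\<exists>!D :: 'k::field grassmann \<Rightarrow> 'k grassmann.
     odd_superderivation D \<and> (\<forall>j. D (gx j) = (if i = j then 1 else 0))"
proof (rule ex1I[of _ "gpartial_expl i"])
  show "D = gpartial_expl i"
    if "odd_superderivation D \<and> (\<forall>j. D (gx j) = (if i = j then 1 else 0))"
    for D :: "'k grassmann \<Rightarrow> 'k grassmann"
    using that
    by (intro odd_superderivation_unique) (simp_all add: odd_superderivation_gpartial_expl gpartial_expl_gx)
qed (simp add: odd_superderivation_gpartial_expl gpartial_expl_gx)

lemma gpartial_eq_expl: "gpartial i = gpartial_expl i"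
  unfolding gpartial_def
  by (rule the1_equality[OF gpartial_unique])
    (simp add: odd_superderivation_gpartial_expl gpartial_expl_gx)

lemma odd_superderivation_gpartial: "odd_superderivation (gpartial i)"
  by (simp add: gpartial_eq_expl odd_superderivation_gpartial_expl)

lemma gpartial_gx: "gpartial i (gx j) = (if i = j then 1 else 0)"
  by (simp add: gpartial_eq_expl gpartial_expl_gx)

lemma gcoeff_gpartial:
  "gcoeff (gpartial i a) U = (if i \<in> U then 0 else gsign {i} U * gcoeff a (insert i U))"
  by (simp add: gpartial_eq_expl gpartial_expl.rep_eq)


section \<open>The pivot elements\<close>

text \<open>
  Multiplying out the nested brackets, \<open>v\<^sub>i = \<Sum>\<^sub>k x\<^sub>i x\<^bsub>i+1\<^esub> \<cdots> x\<^bsub>i+2k-1\<^esub> \<partial>\<^bsub>i+2k\<^esub>\<close>.  Only finitely many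
  summands are nonzero at a given \<open>a\<close>, see \<open>pivot_eq_sum\<close>; by \<open>pivot_rec\<close> and \<open>pivot_unique\<close> this is
  the only family with \<open>v\<^sub>i = \<partial>\<^sub>i + x\<^sub>i x\<^bsub>i+1\<^esub> v\<^bsub>i+2\<^esub>\<close> for all \<open>i\<close>.
\<close>

definition pivot :: "nat \<Rightarrow> 'k::field grassmann \<Rightarrow> 'k grassmann" where
  "pivot i a = Sum_any (\<lambda>k. prod_list (map gx [i..<i + 2 * k]) * gpartial (i + 2 * k) a)"

lemma gletters_bounded: "\<exists>n. \<forall>i\<ge>n. \<forall>S. gcoeff a S \<noteq> 0 \<longrightarrow> i \<notin> S"
proof -
  have "finite (\<Union>{S. gcoeff a S \<noteq> 0})"
    using finite_gsupport[of a] gcoeff_infinite[of _ a] by blast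
  then obtain n where "\<forall>i\<in>\<Union>{S. gcoeff a S \<noteq> 0}. i < n"
    by (meson finite_nat_set_iff_bounded)
  then show ?thesis by (intro exI[of _ n]) (auto simp: not_less[symmetric])
qed

lemma pivot_eq_sum:
  assumes "\<forall>i\<ge>n. \<forall>S. gcoeff a S \<noteq> 0 \<longrightarrow> i \<notin> S" "n \<le> i + 2 * m"
  shows "pivot i a = (\<Sum>k<m. prod_list (map gx [i..<i + 2 * k]) * gpartial (i + 2 * k) a)"
  unfolding pivot_def
proof (rule Sum_any.expand_superset)
  have "gpartial (i + 2 * k) a = 0" if "m \<le> k" for k
  proof (rule grassmann_eqI)
    fix S :: "nat set"
    have "n \<le> i + 2 * k" using that assms(2) by simp
    then have "gcoeff a (insert (i + 2 * k) S) = 0" using assms(1) by blast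
    then show "gcoeff (gpartial (i + 2 * k) a) S = gcoeff 0 S" by (simp add: gcoeff_gpartial)
  qed
  then show "{k. prod_list (map gx [i..<i + 2 * k]) * gpartial (i + 2 * k) a \<noteq> 0} \<subseteq> {..<m}"
    by (auto simp: not_le[symmetric])
qed simp

lemma pivot_rec: "pivot i a = gpartial i a + gx i * gx (i + 1) * pivot (i + 2) a"
proof -
  obtain n where n: "\<forall>i\<ge>n. \<forall>S. gcoeff a S \<noteq> 0 \<longrightarrow> i \<notin> S" using gletters_bounded by blast
  have upt: "[i..<i + 2 * Suc k] = i # (i + 1) # [i + 2..<i + 2 + 2 * k]" for k
    by (simp add: upt_rec)
  have "pivot i a = (\<Sum>k<Suc n. prod_list (map gx [i..<i + 2 * k]) * gpartial (i + 2 * k) a)"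
    by (rule pivot_eq_sum[OF n]) simp
  also have "\<dots> = gpartial i a + gx i * gx (i + 1) *
      (\<Sum>k<n. prod_list (map gx [i + 2..<i + 2 + 2 * k]) * gpartial (i + 2 + 2 * k) a)"
    unfolding sum.lessThan_Suc_shift sum_distrib_left upt by (simp add: mult.assoc)
  also have "(\<Sum>k<n. prod_list (map gx [i + 2..<i + 2 + 2 * k]) * gpartial (i + 2 + 2 * k) a)
      = pivot (i + 2) a"
    by (rule pivot_eq_sum[OF n, symmetric]) simp
  finally show ?thesis .
qed

lemma pivot_unique:
  fixes w :: "nat \<Rightarrow> 'k::field grassmann \<Rightarrow> 'k grassmann"
  assumes "\<And>i a. w i a = gpartial i a + gx i * gx (i + 1) * w (i + 2) a"
  shows "w = pivot"
proof (intro ext)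
  fix i and a :: "'k grassmann"
  define d where "d i = w i a - pivot i a" for i
  have d: "d i = gx i * (gx (i + 1) * d (i + 2))" for i
    unfolding d_def by (subst assms, subst pivot_rec) (simp add: algebra_simps)
  have "gcoeff (d i) U = 0" if "finite U" for i U
    using that
  proof (induction "card U" arbitrary: i U rule: less_induct)
    case less
    have "gcoeff (d (i + 2)) (U - {i} - {i + 1}) = 0" if "i \<in> U"
      using less that by (intro less) (auto intro!: psubset_card_mono)
    then show ?case using less.prems by (subst d) (auto simp: gcoeff_gx_mult)
  qed
  then have "d i = 0" by (intro grassmann_eqI) simp
  then show "w i a = pivot i a" by (simp add: d_def)
qed

lemma linear_pivot: "Vector_Spaces.linear gscale gscale (pivot i :: 'k::field grassmann \<Rightarrow> _)"
  unfolding Vector_Spaces.linear_iff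
proof (intro conjI allI grassmann.vector_space_axioms)
  have lin: "Vector_Spaces.linear gscale gscale (gpartial j :: 'k grassmann \<Rightarrow> _)" for j
    using odd_superderivation_gpartial unfolding odd_superderivation_def by (rule conjunct1)
  fix a b :: "'k grassmann" and c :: 'k
  obtain n where n: "\<forall>i\<ge>n. \<forall>S. gcoeff a S \<noteq> 0 \<longrightarrow> i \<notin> S" using gletters_bounded by blast
  obtain m where m: "\<forall>i\<ge>m. \<forall>S. gcoeff b S \<noteq> 0 \<longrightarrow> i \<notin> S" using gletters_bounded by blast
  have n': "\<forall>i\<ge>n. \<forall>S. gcoeff (gscale c a) S \<noteq> 0 \<longrightarrow> i \<notin> S" using n by auto
  have nm: "\<forall>i\<ge>n + m. \<forall>S. gcoeff (a + b) S \<noteq> 0 \<longrightarrow> i \<notin> S"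
    using n m by (metis add_leE gcoeff_simps(2) add_0)
  show "pivot i (a + b) = pivot i a + pivot i b"
    using lin by (simp add: pivot_eq_sum[OF n, of i "n + m"] pivot_eq_sum[OF m, of i "n + m"]
        pivot_eq_sum[OF nm, of i "n + m"] Vector_Spaces.linear_iff sum.distrib distrib_left)
  show "pivot i (gscale c a) = gscale c (pivot i a)"
    using lin by (simp add: pivot_eq_sum[OF n, of i n] pivot_eq_sum[OF n', of i n]
        Vector_Spaces.linear_iff gscale_mult_right grassmann.scale_sum_right)
qed


section \<open>Generated subalgebras of the endomorphism algebra\<close>

text \<open>The product of \<open>End \<Lambda>\<close> is composition; the linear structure is pointwise.\<close>

definition end_subspace :: "('k::field grassmann \<Rightarrow> 'k grassmann) set \<Rightarrow> bool" where
  "end_subspace V \<longleftrightarrow> (\<forall>f\<in>V. Vector_Spaces.linear gscale gscale f) \<and> (\<lambda>_. 0) \<in> V \<and>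
     (\<forall>f\<in>V. \<forall>g\<in>V. (\<lambda>a. f a + g a) \<in> V) \<and> (\<forall>c. \<forall>f\<in>V. (\<lambda>a. gscale c (f a)) \<in> V)"

definition assoc_subalgebra :: "('k::field grassmann \<Rightarrow> 'k grassmann) set \<Rightarrow> bool" where
  "assoc_subalgebra V \<longleftrightarrow> end_subspace V \<and> (\<forall>f\<in>V. \<forall>g\<in>V. f \<circ> g \<in> V)"

definition Alg :: "('k::field grassmann \<Rightarrow> 'k grassmann) set \<Rightarrow> ('k grassmann \<Rightarrow> 'k grassmann) set" where
  "Alg X = assoc_subalgebra hull X"

text \<open>
  Characteristic \<open>2\<close> only: there the bracket is \<open>[f, g] = fg + gf\<close> and the \<open>p\<close>-mapping is \<open>f \<mapsto> f\<^sup>2\<close>.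
\<close>

definition pmap2 :: "('k grassmann \<Rightarrow> 'k grassmann) \<Rightarrow> 'k::field grassmann \<Rightarrow> 'k grassmann" where
  "pmap2 f = f \<circ> f"

definition restricted_subalgebra2 :: "('k::field grassmann \<Rightarrow> 'k grassmann) set \<Rightarrow> bool" where
  "restricted_subalgebra2 V \<longleftrightarrow> end_subspace V \<and>
     (\<forall>f\<in>V. \<forall>g\<in>V. (\<lambda>a. f (g a) + g (f a)) \<in> V) \<and> (\<forall>f\<in>V. pmap2 f \<in> V)"

definition Lie_p2 :: "('k::field grassmann \<Rightarrow> 'k grassmann) set \<Rightarrow> ('k grassmann \<Rightarrow> 'k grassmann) set" where
  "Lie_p2 X = restricted_subalgebra2 hull X"

definition nil_algebra :: "('k::field grassmann \<Rightarrow> 'k grassmann) set \<Rightarrow> bool" where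
  "nil_algebra A \<longleftrightarrow> (\<forall>f\<in>A. \<exists>n>0. f ^^ n = (\<lambda>_. 0))"

definition nil_restricted2 :: "('k::field grassmann \<Rightarrow> 'k grassmann) set \<Rightarrow> bool" where
  "nil_restricted2 L \<longleftrightarrow> (\<forall>f\<in>L. \<exists>n. (pmap2 ^^ n) f = (\<lambda>_. 0))"

text \<open>
  The family intersected by each hull is nonempty, so that the hull is again a subalgebra.
\<close>

lemma end_subspace_linear: "end_subspace {f :: 'k::field grassmann \<Rightarrow> 'k grassmann. Vector_Spaces.linear gscale gscale f}"
  by (auto simp: end_subspace_def Vector_Spaces.linear_iff grassmann.vector_space_axioms
      grassmann.scale_right_distrib algebra_simps)

lemma assoc_subalgebra_Alg:
  assumes "\<forall>f\<in>X. Vector_Spaces.linear gscale gscale f"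
  shows "assoc_subalgebra (Alg X)"
proof -
  let ?E = "{f :: 'a grassmann \<Rightarrow> 'a grassmann. Vector_Spaces.linear gscale gscale f}"
  have "assoc_subalgebra ?E"
    by (auto simp: assoc_subalgebra_def end_subspace_linear) (simp add: Vector_Spaces.linear_iff)
  then have "Alg X \<subseteq> ?E" unfolding Alg_def by (rule hull_minimal[rotated]) (use assms in auto)
  then show ?thesis
    unfolding Alg_def hull_def assoc_subalgebra_def end_subspace_def by auto
qed

lemma restricted_subalgebra2_Lie_p2:
  assumes "\<forall>f\<in>X. Vector_Spaces.linear gscale gscale f"
  shows "restricted_subalgebra2 (Lie_p2 X)"
proof -
  let ?E = "{f :: 'a grassmann \<Rightarrow> 'a grassmann. Vector_Spaces.linear gscale gscale f}"
  have "restricted_subalgebra2 ?E"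
    by (auto simp: restricted_subalgebra2_def end_subspace_linear pmap2_def)
      (auto simp add: Vector_Spaces.linear_iff grassmann.scale_right_distrib algebra_simps)
  then have "Lie_p2 X \<subseteq> ?E"
    unfolding Lie_p2_def by (rule hull_minimal[rotated]) (use assms in auto)
  then show ?thesis
    unfolding Lie_p2_def hull_def restricted_subalgebra2_def end_subspace_def by auto
qed

end

theory Submission
  imports Defs
begin

text \<open>
  Let \<open>f\<^sub>i = v\<^sub>i + x\<^sub>i v\<^bsub>i+1\<^esub>\<close>.  From \<open>v\<^sub>i\<^sup>2 = x\<^bsub>i+1\<^esub> v\<^bsub>i+2\<^esub>\<close> one gets \<open>f\<^sub>1 = v\<^sub>1 + v\<^sub>0\<^sup>2\<close> and
  \<open>f\<^sub>i\<^sup>2 = f\<^bsub>i+1\<^esub> - 2 x\<^sub>i v\<^sub>i v\<^bsub>i+1\<^esub>\<close>.  Hence, modulo twice the elements with integer coefficients, the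
  \<open>2\<^sup>n\<close>-th power of \<open>f\<^sub>1\<close> is \<open>f\<^bsub>n+1\<^esub>\<close>, and \<open>f\<^bsub>n+1\<^esub>\<close> maps \<open>x\<^bsub>n+1\<^esub>\<close> to \<open>1\<close>.  In characteristic \<open>0\<close> or
  \<open>2\<close> the unit \<open>1\<close> is not twice an integer, so no power of \<open>f\<^sub>1\<close> vanishes.
\<close>

section \<open>Relations between multiplication by generators and partial derivatives\<close>

lemma gpartial_add: "gpartial i (a + b) = gpartial i a + gpartial i b"
  using odd_superderivation_gpartial unfolding odd_superderivation_def Vector_Spaces.linear_iff
  by blast

lemma pivot_add: "pivot i (a + b) = pivot i a + pivot i b"
  using linear_pivot unfolding Vector_Spaces.linear_iff by blast

lemma pivot_zero [simp]: "pivot i 0 = 0"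
  using pivot_add[of i 0 0] by simp

lemma gx_gx_mult: "gx i * (gx i * a) = 0"
  by (simp add: gx_square flip: mult.assoc)

lemma gx_mult_left_commute: "gx i * (gx j * a) = - (gx j * (gx i * a))"
  unfolding mult.assoc[symmetric] gx_anticommute[of i j] by simp

lemma gpartial_gx_mult: "gpartial j (gx i * b) = (if i = j then b else 0) - gx i * gpartial j b"
  using odd_superderivation_mult[OF odd_superderivation_gpartial homogeneous_gx, of j i b]
  by (simp add: gpartial_gx)

lemma gsign_singletons:
  "i \<noteq> j \<Longrightarrow> gsign {i} {j} = - (gsign {j} {i} :: 'k::comm_ring_1)"
proof -
  assume "i \<noteq> j"
  then have "gsign {i} {j} * gsign {j} {i} = (- 1 :: 'k)"
    using gsign_swap_singleton[of "{i}" j] by simp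
  then have "gsign {i} {j} * gsign {j} {i} * gsign {j} {i} = - (gsign {j} {i} :: 'k)"
    by (simp only: mult_minus1)
  then show ?thesis by (simp only: mult.assoc gsign_square mult_1_right)
qed

lemma gpartial_gpartial [simp]: "gpartial i (gpartial i a) = 0"
  by (rule grassmann_eqI) (simp add: gcoeff_gpartial)

lemma gpartial_anticommute: "gpartial i (gpartial j a) = - gpartial j (gpartial i a)"
proof (cases "i = j")
  case True
  then show ?thesis by simp
next
  case False
  show ?thesis
  proof (rule grassmann_eqI)
    fix U :: "nat set" assume U: "finite U"
    show "gcoeff (gpartial i (gpartial j a)) U = gcoeff (- gpartial j (gpartial i a)) U"
    proof (cases "i \<in> U \<or> j \<in> U")
      case True
      then show ?thesis by (auto simp: gcoeff_gpartial)
    next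
      case not_in: False
      have "gsign {i} (insert j U) = (gsign {i} {j} * gsign {i} U :: 'a)"
        "gsign {j} (insert i U) = (gsign {j} {i} * gsign {j} U :: 'a)"
        using U not_in gsign_Un_right[of "{j}" U "{i}"] gsign_Un_right[of "{i}" U "{j}"] by simp_all
      then show ?thesis
        using not_in False
        by (simp add: gcoeff_gpartial insert_commute gsign_singletons[of i j])
    qed
  qed
qed

section \<open>Commutation rules for the pivot elements\<close>

text \<open>Each use of the recursion removes two letters from the monomial \<open>U\<close>, so
  induction on \<open>card U\<close> applies. Identities for pivots follow by checking that the
  difference of both sides satisfies this recursion.\<close>

lemma gx_gx_recursion_eq_0:
  assumes "\<And>j. n \<le> j \<Longrightarrow> d j = gx j * (gx (j + 1) * d (j + 2))" and "n \<le> j"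
  shows "d j = (0 :: 'k::comm_ring_1 grassmann)"
proof -
  have "gcoeff (d j) U = 0" if "finite U" "n \<le> j" for j U
    using that
  proof (induction "card U" arbitrary: j U rule: less_induct)
    case less
    have "gcoeff (d (j + 2)) (U - {j} - {j + 1}) = 0" if "j \<in> U"
      using less that by (intro less) (auto intro!: psubset_card_mono)
    then show ?case
      using less.prems by (subst assms(1)) (auto simp: gcoeff_gx_mult)
  qed
  then show ?thesis using assms(2) by (intro grassmann_eqI) simp
qed

text \<open>The defect satisfies the recursion: for \<open>j > i\<close>, \<open>x_i\<close>
  anticommutes with \<open>gpartial j\<close> and commutes with the even product
  \<open>x_j x_(j+1)\<close>.\<close>

lemma pivot_gx_mult_less:
  assumes "i < j"
  shows "pivot j (gx i * b) = - (gx i * pivot j b)"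
proof -
  have "pivot j (gx i * b) + gx i * pivot j b = 0"
  proof (rule gx_gx_recursion_eq_0[where n = "Suc i" and d = "\<lambda>j. pivot j (gx i * b) + gx i * pivot j b"])
    fix j assume "Suc i \<le> j"
    then have "i \<noteq> j" by simp
    have "gx i * (gx j * (gx (j + 1) * c)) = gx j * (gx (j + 1) * (gx i * c))" for c :: "'a grassmann"
      by (simp add: gx_mult_left_commute[of i j] gx_mult_left_commute[of i "Suc j"])
    then show "pivot j (gx i * b) + gx i * pivot j b =
        gx j * (gx (j + 1) * (pivot (j + 2) (gx i * b) + gx i * pivot (j + 2) b))"
      using \<open>i \<noteq> j\<close>
      unfolding pivot_rec[of j "gx i * b"] pivot_rec[of j b]
      by (simp add: gpartial_gx_mult distrib_left mult.assoc)
  qed (use assms in simp)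
  then show ?thesis by (simp add: eq_neg_iff_add_eq_0)
qed

lemma gx_pivot: "gx i * pivot i a = gx i * gpartial i a"
  by (subst pivot_rec) (simp add: distrib_left mult.assoc gx_gx_mult)

text \<open>The tail of \<open>v_i\<close> dies on \<open>x_i b\<close>: moving \<open>x_i\<close>
  past \<open>v_(i+2)\<close> produces \<open>x_i x_(i+1) x_i = 0\<close>. Only the Leibniz rule for
  \<open>gpartial i\<close> remains.\<close>

lemma pivot_gx_mult_self: "pivot i (gx i * b) = b - gx i * pivot i b"
proof -
  have "gx i * (gx (Suc i) * (gx i * c)) = 0" for c :: "'a grassmann"
    by (subst gx_mult_left_commute) (simp add: gx_gx_mult)
  then have "pivot i (gx i * b) = gpartial i (gx i * b)"
    by (subst pivot_rec) (simp add: pivot_gx_mult_less mult.assoc)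
  then show ?thesis by (simp add: gpartial_gx_mult gx_pivot)
qed

lemma gpartial_pivot_less:
  assumes "i < j"
  shows "gpartial i (pivot j a) = - pivot j (gpartial i a)"
proof -
  have "gpartial i (pivot j a) + pivot j (gpartial i a) = 0"
  proof (rule gx_gx_recursion_eq_0[where n = "Suc i"
        and d = "\<lambda>j. gpartial i (pivot j a) + pivot j (gpartial i a)"])
    fix j assume "Suc i \<le> j"
    then have "j \<noteq> i" "Suc j \<noteq> i" by simp_all
    then show "gpartial i (pivot j a) + pivot j (gpartial i a) =
        gx j * (gx (j + 1) * (gpartial i (pivot (j + 2) a) + pivot (j + 2) (gpartial i a)))"
      unfolding pivot_rec[of j a] pivot_rec[of j "gpartial i a"]
      by (simp add: gpartial_add gpartial_gx_mult distrib_left mult.assoc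
          gpartial_anticommute[of i j])
  qed (use assms in simp)
  then show ?thesis by (simp add: eq_neg_iff_add_eq_0)
qed

text \<open>In the expansion \<open>gpartial i\<close> squares to zero, and so does the tail because
  \<open>x_i\<close> occurs twice. Of the mixed terms, those containing \<open>x_i\<close> cancel,
  since \<open>gpartial i\<close> anticommutes with \<open>v_(i+2)\<close>.\<close>

lemma pivot_square: "pivot i (pivot i a) = gx (i + 1) * pivot (i + 2) a"
proof -
  have rec: "pivot i b = gpartial i b + gx i * (gx (i + 1) * pivot (i + 2) b)" for b :: "'a grassmann"
    by (subst pivot_rec) (simp only: mult.assoc)
  let ?b = "gpartial i a + gx i * (gx (i + 1) * pivot (i + 2) a)"
  have "pivot i (pivot i a) = pivot i ?b"
    by (simp only: rec[of a])
  also have "\<dots> = gpartial i ?b + gx i * (gx (i + 1) * pivot (i + 2) ?b)"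
    by (rule rec)
  finally show ?thesis
    by (simp add: gpartial_add pivot_add gpartial_gx_mult pivot_gx_mult_less gpartial_pivot_less
        distrib_left mult.assoc gx_gx_mult gx_mult_left_commute[of "Suc i" i])
qed

text \<open>The factor \<open>x_i\<close> reduces \<open>v_i\<close> to \<open>gpartial i\<close>,
  even behind \<open>v_(i+1)\<close>, and \<open>gpartial i\<close> anticommutes with
  \<open>v_(i+1)\<close>.\<close>

lemma gx_pivot_anticommute:
  "gx i * pivot (i + 1) (pivot i a) = - (gx i * pivot i (pivot (i + 1) a))"
proof -
  have "gx i * pivot (i + 1) (pivot i a) = gx i * pivot (i + 1) (gpartial i a)"
    by (subst (2) pivot_rec)
      (simp add: pivot_add pivot_gx_mult_less distrib_left right_diff_distrib mult.assoc gx_gx_mult)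
  then show ?thesis
    by (simp add: gx_pivot gpartial_pivot_less)
qed


section \<open>The operators \<open>f_i\<close> and their squares\<close>

definition pivot_plus :: "nat \<Rightarrow> 'k::field grassmann \<Rightarrow> 'k grassmann" where
  "pivot_plus i a = pivot i a + gx i * pivot (i + 1) a"

lemma pivot_plus_add: "pivot_plus i (a + b) = pivot_plus i a + pivot_plus i b"
  by (simp add: pivot_plus_def pivot_add algebra_simps)

text \<open>Since \<open>v_0\<^sup>2\<close> is both a product and a value of the
  \<open>p\<close>-mapping, this places \<open>f_1\<close> in both generated algebras.\<close>

lemma pivot_plus_1: "pivot_plus 1 = (\<lambda>a. pivot 1 a + (pivot 0 \<circ> pivot 0) a)"
  by (simp add: pivot_plus_def pivot_square fun_eq_iff)

text \<open>Here \<open>v_i x_i = 1 - x_i v_i\<close> contributes \<open>v_(i+1)\<close>, which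
  together with \<open>v_i\<^sup>2\<close> forms \<open>f_(i+1)\<close>. By anticommutation behind
  \<open>x_i\<close>, the two leftover mixed terms are equal.\<close>

lemma pivot_plus_square:
  "pivot_plus i (pivot_plus i a) = pivot_plus (i + 1) a +
     (- (gx i * pivot i (pivot (i + 1) a)) + - (gx i * pivot i (pivot (i + 1) a)))"
  using gx_pivot_anticommute[of i a]
  by (simp add: pivot_plus_def pivot_add pivot_square pivot_gx_mult_self pivot_gx_mult_less
      distrib_left gx_gx_mult algebra_simps)

lemma pivot_plus_gx: "pivot_plus i (gx i) = 1"
proof -
  have "gpartial j 1 = (0 :: 'a grassmann)" for j
    by (rule grassmann_eqI) (simp add: gcoeff_gpartial one_grassmann.rep_eq)
  then have one: "pivot j 1 = (0 :: 'a grassmann)" for j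
    by (simp add: pivot_def)
  show ?thesis
    using pivot_gx_mult_self[of i "1 :: 'a grassmann"]
      pivot_gx_mult_less[of i "i + 1" "1 :: 'a grassmann"]
    by (simp add: pivot_plus_def one)
qed


section \<open>Congruences modulo twice the integral elements\<close>

text \<open>In characteristic 0 every element of the whole algebra is a double; integral
  coefficients make a congruence modulo 2 meaningful. In characteristic 2 doubles vanish, so both
  cases share one argument.\<close>

definition grassmann_Ints :: "'k::comm_ring_1 grassmann set" where
  "grassmann_Ints = {a. \<forall>S. gcoeff a S \<in> \<int>}"

lemma grassmann_Ints_add: "a \<in> grassmann_Ints \<Longrightarrow> b \<in> grassmann_Ints \<Longrightarrow> a + b \<in> grassmann_Ints"
  by (simp add: grassmann_Ints_def)

lemma grassmann_Ints_minus: "a \<in> grassmann_Ints \<Longrightarrow> - a \<in> grassmann_Ints"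
  by (simp add: grassmann_Ints_def)

lemma grassmann_Ints_gx: "gx i \<in> grassmann_Ints"
  by (simp add: grassmann_Ints_def gx.rep_eq)

lemma gsign_in_Ints: "gsign S T \<in> \<int>"
  by (simp add: gsign_def)

lemma grassmann_Ints_mult: "a \<in> grassmann_Ints \<Longrightarrow> b \<in> grassmann_Ints \<Longrightarrow> a * b \<in> grassmann_Ints"
  by (auto simp: grassmann_Ints_def times_grassmann.rep_eq intro!: Ints_sum Ints_mult gsign_in_Ints)

lemma grassmann_Ints_gpartial: "a \<in> grassmann_Ints \<Longrightarrow> gpartial i a \<in> grassmann_Ints"
  by (simp add: grassmann_Ints_def gcoeff_gpartial gsign_in_Ints)

lemma grassmann_Ints_pivot:
  assumes "a \<in> grassmann_Ints"
  shows "pivot i a \<in> grassmann_Ints"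
proof -
  obtain n where n: "\<forall>i\<ge>n. \<forall>S. gcoeff a S \<noteq> 0 \<longrightarrow> i \<notin> S" using gletters_bounded by blast
  have one: "1 \<in> grassmann_Ints"
    by (simp add: grassmann_Ints_def one_grassmann.rep_eq)
  have "prod_list (map gx xs) \<in> grassmann_Ints" for xs
    by (induction xs) (simp_all add: one grassmann_Ints_mult grassmann_Ints_gx)
  then have "prod_list (map gx [i..<i + 2 * k]) * gpartial (i + 2 * k) a \<in> grassmann_Ints" for k
    by (intro grassmann_Ints_mult grassmann_Ints_gpartial assms)
  then show ?thesis
    by (simp add: pivot_eq_sum[OF n, of i n] grassmann_Ints_def gcoeff_sum Ints_sum)
qed

lemma grassmann_Ints_pivot_plus: "a \<in> grassmann_Ints \<Longrightarrow> pivot_plus i a \<in> grassmann_Ints"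
  unfolding pivot_plus_def
  by (intro grassmann_Ints_add grassmann_Ints_mult grassmann_Ints_pivot grassmann_Ints_gx)

text \<open>The induction step squares \<open>?g\<close> and uses the hypothesis at \<open>a\<close>
  and at \<open>f_(i+n) a\<close>, hence the generalization over \<open>a\<close>. Additivity turns
  \<open>?g (c + c)\<close> into a double again.\<close>

lemma pivot_plus_power_two_cong:
  assumes "a \<in> grassmann_Ints"
  shows "\<exists>c\<in>grassmann_Ints. (pivot_plus i ^^ 2 ^ n) a = pivot_plus (i + n) a + (c + c)"
  using assms
proof (induction n arbitrary: a)
  case 0
  show ?case by (rule bexI[of _ 0]) (simp_all add: grassmann_Ints_def)
next
  case (Suc n)
  let ?g = "pivot_plus i ^^ 2 ^ n"
  have add: "(pivot_plus i ^^ m) (b + b') = (pivot_plus i ^^ m) b + (pivot_plus i ^^ m) b'"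
    for m and b b' :: "'a grassmann"
    by (induction m) (simp_all add: pivot_plus_add)
  have Ints: "(pivot_plus i ^^ m) b \<in> grassmann_Ints"
    if "b \<in> grassmann_Ints" for m and b :: "'a grassmann"
    by (induction m) (simp_all add: that grassmann_Ints_pivot_plus)
  obtain c where c: "c \<in> grassmann_Ints" "?g a = pivot_plus (i + n) a + (c + c)"
    using Suc by blast
  obtain d where d: "d \<in> grassmann_Ints"
    "?g (pivot_plus (i + n) a) = pivot_plus (i + n) (pivot_plus (i + n) a) + (d + d)"
    using Suc grassmann_Ints_pivot_plus by blast
  define e where "e = - (gx (i + n) * pivot (i + n) (pivot (i + n + 1) a))"
  have e: "e \<in> grassmann_Ints"
    unfolding e_def using Suc.prems
    by (intro grassmann_Ints_minus grassmann_Ints_mult grassmann_Ints_gx grassmann_Ints_pivot)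
  have "(pivot_plus i ^^ 2 ^ Suc n) a = ?g (?g a)"
    by (simp add: mult_2 funpow_add)
  also have "\<dots> = pivot_plus (i + Suc n) a + ((e + d + ?g c) + (e + d + ?g c))"
    unfolding c(2) add d(2) pivot_plus_square e_def[symmetric] by (simp add: ac_simps)
  finally show ?case
    using c(1) d(1) e by (intro bexI[of _ "e + d + ?g c"] grassmann_Ints_add Ints)
qed

section \<open>Powers of \<open>f_i\<close> do not vanish\<close>

text \<open>Otherwise the characteristic would divide the odd number \<open>2 * z - 1\<close>. An
  odd characteristic \<open>p\<close> would allow \<open>r = (p + 1) / 2\<close>.\<close>

lemma Ints_double_neq_1:
  assumes "CHAR('k::field) = 0 \<or> CHAR('k) = 2" and "r \<in> \<int>"
  shows "r + r \<noteq> (1 :: 'k)"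
proof
  assume eq: "r + r = 1"
  obtain z where "r = of_int z" using assms(2) by (rule Ints_cases)
  then have "of_int (2 * z - 1) = (0 :: 'k)" using eq by simp
  then have "int CHAR('k) dvd 2 * z - 1" by (simp only: of_int_eq_0_iff_char_dvd)
  with assms(1) show False by (auto; presburger)
qed

lemma pivot_plus_funpow_neq_0:
  assumes "CHAR('k::field) = 0 \<or> CHAR('k) = 2"
  shows "(pivot_plus i :: 'k grassmann \<Rightarrow> 'k grassmann) ^^ n \<noteq> (\<lambda>_. 0)"
proof
  let ?f = "pivot_plus i :: 'k grassmann \<Rightarrow> 'k grassmann"
  assume *: "?f ^^ n = (\<lambda>_. 0)"
  have "?f 0 = 0" by (simp add: pivot_plus_def)
  then have "(?f ^^ m) 0 = 0" for m by (induction m) simp_all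
  \<comment> \<open>As \<open>n < 2 ^ n\<close>, vanishing of the \<open>n\<close>-th power passes
    to the \<open>2 ^ n\<close>-th, where the congruence applies.\<close>
  moreover have "2 ^ n = (2 ^ n - n) + n" using less_exp[of n] by simp
  then have "(?f ^^ 2 ^ n) a = (?f ^^ (2 ^ n - n)) ((?f ^^ n) a)" for a
    by (metis funpow_add comp_apply)
  ultimately have zero: "(?f ^^ 2 ^ n) a = 0" for a by (simp add: *)
  \<comment> \<open>The generator \<open>x_(i+n)\<close> is chosen because \<open>f_(i+n)\<close>
    maps it to 1; the constant coefficient then exhibits 1 as a double.\<close>
  obtain c where c: "c \<in> grassmann_Ints"
    "(?f ^^ 2 ^ n) (gx (i + n)) = pivot_plus (i + n) (gx (i + n)) + (c + c)"
    using pivot_plus_power_two_cong[OF grassmann_Ints_gx] by blast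
  then have "1 + (c + c) = 0" by (simp only: zero pivot_plus_gx)
  then have "gcoeff (1 + (c + c)) {} = 0" by simp
  then have "- gcoeff c {} + - gcoeff c {} = 1"
    by (simp add: one_grassmann.rep_eq algebra_simps add_eq_0_iff)
  moreover have "- gcoeff c {} \<in> \<int>" using c(1) by (simp add: grassmann_Ints_def)
  ultimately show False using Ints_double_neq_1[OF assms] by blast
qed

text \<open>Reduces nilpotency under the \<open>p\<close>-mapping to vanishing of ordinary
  powers.\<close>

lemma pmap2_funpow: "(pmap2 ^^ n) f = f ^^ (2 ^ n)"
  by (induction n) (simp_all add: pmap2_def mult_2 funpow_add)

theorem lemma12p4:
  assumes "CHAR('k::field) = 0 \<or> CHAR('k) = 2"
  shows "\<not> nil_algebra (Alg {pivot 0, pivot 1 :: 'k grassmann \<Rightarrow> 'k grassmann}) \<and>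
    (CHAR('k) = 2 \<longrightarrow>
      \<not> nil_restricted2 (Lie_p2 {pivot 0, pivot 1 :: 'k grassmann \<Rightarrow> 'k grassmann}))"
proof -
  let ?X = "{pivot 0, pivot 1 :: 'k grassmann \<Rightarrow> 'k grassmann}"
  have lin: "\<forall>f\<in>?X. Vector_Spaces.linear gscale gscale f" by (simp add: linear_pivot)
  have "?X \<subseteq> Alg ?X" unfolding Alg_def by (rule hull_subset)
  then have "pivot_plus 1 \<in> Alg ?X"
    using assoc_subalgebra_Alg[OF lin]
    unfolding pivot_plus_1 assoc_subalgebra_def end_subspace_def by blast
  then have "\<not> nil_algebra (Alg ?X)"
    using pivot_plus_funpow_neq_0[OF assms] unfolding nil_algebra_def by blast
  moreover have "?X \<subseteq> Lie_p2 ?X" unfolding Lie_p2_def by (rule hull_subset)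
  then have "pivot_plus 1 \<in> Lie_p2 ?X"
    using restricted_subalgebra2_Lie_p2[OF lin]
    unfolding pivot_plus_1 restricted_subalgebra2_def end_subspace_def pmap2_def by blast
  then have "\<not> nil_restricted2 (Lie_p2 ?X)"
    using pivot_plus_funpow_neq_0[OF assms] unfolding nil_restricted2_def pmap2_funpow by blast
  ultimately show ?thesis by blast
qed

end
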